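(* Let $\mathcal{B}(x)=\Gamma(x)^2/\Gamma(2x)$ for $x>0$. The following statements are valid. (i) For all $x\in(0,\infty)$, $$(-1)^n\left[\ln\left(\frac{x}{2}\mathcal{B}(x)\right)\right]^{(n)}\ \begin{cases}<0 & \text{for } n=0,\\ >0 & \text{for } n=1,\\ <0 & \text{for all integers } n\ge 2.\end{cases}$$ Consequently, the function $x\mapsto -\left[\ln\left(x\mathcal{B}(x)\right)\right]''$ is completely monotonic on $(0,\infty)$. (ii) $\ln\mathcal{B}(x)$ has the power series expansion $$\ln\mathcal{B}(x)=\ln 2-\ln x+\sum_{n=2}^{\infty}(-1)^{n-1}\frac{(2^n-2)\zeta(n)}{n}x^n,$$ which is convergent on $(0,1/2]$. (iii) For every integer $n\ge 2$, the function $$x\mapsto (-1)^n\,\frac{\ln\mathcal{B}(x)+\ln x-\ln 2-\sum_{k=2}^{n}(-1)^{k-1}(2^k-2)k^{-1}\zeta(k)x^k}{x^{n+1}}$$ is completely monotonic on $(0,\infty)$.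
   Context: $\Gamma$ is the gamma function and $\zeta(s)=\sum_{n=1}^\infty n^{-s}$ is the Riemann zeta function. The superscript $(n)$ denotes the $n$-th derivative with respect to $x$, and the $0$-th derivative is the function itself. A function $f$ is completely monotonic on an interval $I$ if it has derivatives of all orders on $I$ and $(-1)^m f^{(m)}(x)\ge 0$ for all $x\in I$ and all integers $m\ge 0$. *)

theory Defs
  imports "HOL-Analysis.Analysis"
begin

definition central_beta :: "real \<Rightarrow> real" where
  "central_beta x = Gamma x ^ 2 / Gamma (2 * x)"

text \<open>The Dirichlet series of the Riemann zeta function. It is meaningful only for \<open>s > 1\<close>;
  elsewhere the series diverges and the value is unspecified.\<close>

definition zeta :: "real \<Rightarrow> real" where
  "zeta s = (\<Sum>n. real (Suc n) powr (- s))"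

text \<open>\<open>D m\<close> is the \<open>m\<close>-th derivative of \<open>f\<close> on \<open>I\<close>, which is unique on a nondegenerate interval.
  Differentiating within \<open>I\<close> gives one-sided derivatives at endpoints belonging to \<open>I\<close>
  and the ordinary two-sided derivatives when \<open>I\<close> is open.\<close>

definition completely_monotonic_on :: "real set \<Rightarrow> (real \<Rightarrow> real) \<Rightarrow> bool" where
  "completely_monotonic_on I f \<longleftrightarrow>
     (\<exists>D :: nat \<Rightarrow> real \<Rightarrow> real.
        (\<forall>x\<in>I. D 0 x = f x) \<and>
        (\<forall>m. \<forall>x\<in>I. (D m has_real_derivative D (Suc m) x) (at x within I)) \<and>
        (\<forall>m. \<forall>x\<in>I. (-1) ^ m * D m x \<ge> 0))"

definition ln_central_beta_coeff :: "nat \<Rightarrow> real" where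
  "ln_central_beta_coeff n = (-1) ^ (n - 1) * (2 ^ n - 2) * zeta (real n) / real n"

end

theory Submission
  imports Defs
begin

text \<open>
  Write \<open>g x = ln (x / 2 * central_beta x) = 2 ln \<Gamma>(x + 1) - ln \<Gamma>(2x + 1)\<close>. Legendre's duplication
  formula gives \<open>g x = ln \<Gamma>(x + 1) - ln \<Gamma>(x + 1/2) - 2 x ln 2 + ln \<pi> / 2\<close>, a smooth
  function on \<open>x > -1/2\<close> whose derivatives of order at least two are differences of polygamma values
  at \<open>x + 1\<close> and \<open>x + 1/2\<close>; their signs follow from the monotonicity of the polygamma
  functions, and \<open>g 0 = g' 0 = 0\<close> gives the signs of \<open>g'\<close> and \<open>g\<close>. The first form of \<open>g\<close>
  gives the Taylor coefficients at \<open>0\<close>. The integral form of the Taylor remainder \<open>R\<^sub>n\<close>,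
  \<open>R\<^sub>n(x) / x\<^sup>n\<^sup>+\<^sup>1 = (1/n!) \<integral>\<^sub>0\<^sup>1 (1 - t)\<^sup>n g\<^sup>(\<^sup>n\<^sup>+\<^sup>1\<^sup>)(x t) dt\<close>, inherits complete monotonicity. Finally
  \<open>(-1)\<^sup>n R\<^sub>n(x) \<ge> 0\<close> for all \<open>n \<ge> 2\<close> forces \<open>R\<^sub>n\<close> to be dominated by
  the next term of the series, which tends to \<open>0\<close> even at \<open>x = 1/2\<close>.
\<close>

section \<open>Iterated derivatives and complete monotonicity\<close>

text \<open>Identifies \<open>deriv ^^ n\<close> with an explicit tower of derivatives. Openness of
  \<open>S\<close> allows an equality valid on \<open>S\<close> to be differentiated again.\<close>

lemma higher_deriv_eqI:
  fixes D :: "nat \<Rightarrow> 'a::real_normed_field \<Rightarrow> 'a"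
  assumes "open S"
    and D0: "\<And>x. x \<in> S \<Longrightarrow> f x = D 0 x"
    and D: "\<And>m x. x \<in> S \<Longrightarrow> (D m has_field_derivative D (Suc m) x) (at x)"
    and "x \<in> S"
  shows "((deriv ^^ n) f has_field_derivative D (Suc n) x) (at x)"
    and "(deriv ^^ n) f x = D n x"
proof -
  have step: "((deriv ^^ n) f has_field_derivative D (Suc n) y) (at y)"
    if "\<And>y. y \<in> S \<Longrightarrow> (deriv ^^ n) f y = D n y" "y \<in> S" for n y
    by (rule has_field_derivative_transform_within_open[OF D[OF that(2)] \<open>open S\<close> that(2)])
      (simp add: that(1))
  have eq: "(deriv ^^ n) f y = D n y" if "y \<in> S" for n y
    using that
  proof (induction n arbitrary: y)
    case (Suc n)
    show ?case using DERIV_imp_deriv[OF step[OF Suc.IH Suc.prems]] by simp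
  qed (simp add: D0)
  show "(deriv ^^ n) f x = D n x" using eq assms(4) by blast
  show "((deriv ^^ n) f has_field_derivative D (Suc n) x) (at x)"
    using step[OF eq] assms(4) by blast
qed

lemma completely_monotonic_on_cong:
  assumes "\<And>x. x \<in> I \<Longrightarrow> f x = g x"
  shows "completely_monotonic_on I f \<longleftrightarrow> completely_monotonic_on I g"
  unfolding completely_monotonic_on_def using assms by auto

lemma completely_monotonic_on_nonneg:
  assumes "completely_monotonic_on I f" "x \<in> I"
  shows "f x \<ge> 0"
  using assms unfolding completely_monotonic_on_def
  by (metis mult_1 power_0)

section \<open>Quotients of Taylor remainders\<close>

text \<open>Taylor's formula on the fixed interval [0, 1] is applied to \<open>t\<close> ->
  \<open>D 0 (x * t)\<close>. The chain rule yields the factor \<open>x ^ Suc n\<close>, so after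
  division \<open>x\<close> survives only inside the argument of \<open>D (Suc n)\<close>.\<close>

lemma taylor_remainder_quotient_eq_integral:
  fixes D :: "nat \<Rightarrow> real \<Rightarrow> real"
  assumes D: "\<And>m x. x \<ge> 0 \<Longrightarrow> (D m has_real_derivative D (Suc m) x) (at x within {0..})"
    and "x > 0"
  shows "(D 0 x - (\<Sum>k\<le>n. D k 0 / fact k * x ^ k)) / x ^ Suc n =
           integral {0..1} (\<lambda>t. (1 - t) ^ n * D (Suc n) (x * t)) / fact n"
proof -
  have dv: "((\<lambda>t. x ^ m * D m (x * t)) has_vector_derivative x ^ Suc m * D (Suc m) (x * t))
      (at t within {0..1})" if "0 \<le> t" "t \<le> 1" for m t
  proof -
    have "((\<lambda>t. D m (x * t)) has_real_derivative D (Suc m) (x * t) * x) (at t within {0..1})"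
    proof (rule DERIV_image_chain[of "D m" _ "\<lambda>t. x * t", unfolded o_def])
      show "(D m has_real_derivative D (Suc m) (x * t)) (at (x * t) within (*) x ` {0..1})"
        by (rule DERIV_subset[OF D]) (use assms(2) that in auto)
    qed (auto intro!: derivative_eq_intros)
    from DERIV_cmult[OF this, of "x ^ m"]
    show ?thesis by (simp add: has_real_derivative_iff_has_vector_derivative mult_ac)
  qed
  have "D 0 x = (\<Sum>i<Suc n. (1 ^ i / fact i) *\<^sub>R (x ^ i * D i (x * 0))) +
      integral {0..1} (\<lambda>t. ((1 - t) ^ n / fact n) *\<^sub>R (x ^ Suc n * D (Suc n) (x * t)))"
    using Taylor_integral[of "Suc n" "\<lambda>i t. x ^ i * D i (x * t)" "\<lambda>t. D 0 (x * t)" 0 1, OF _ _ dv]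
    by simp
  also have "(\<lambda>t. ((1 - t) ^ n / fact n) *\<^sub>R (x ^ Suc n * D (Suc n) (x * t))) =
      (\<lambda>t. (x ^ Suc n / fact n) * ((1 - t) ^ n * D (Suc n) (x * t)))"
    by (simp add: fun_eq_iff)
  finally have "D 0 x = (\<Sum>k\<le>n. D k 0 / fact k * x ^ k) +
      x ^ Suc n / fact n * integral {0..1} (\<lambda>t. (1 - t) ^ n * D (Suc n) (x * t))"
    by (simp add: lessThan_Suc_atMost mult.commute del: power_Suc)
  with assms(2) show ?thesis by (simp add: field_simps del: power_Suc)
qed

text \<open>Each differentiation under the integral sign contributes a factor \<open>t\<close>,
  nonnegative on [0, 1], and raises the order of \<open>D\<close> by one, so \<open>sgn\<close>
  fixes the sign of every derivative.\<close>

lemma completely_monotonic_on_taylor_remainder_quotient: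
  fixes D :: "nat \<Rightarrow> real \<Rightarrow> real"
  assumes D: "\<And>m x. x \<ge> 0 \<Longrightarrow> (D m has_real_derivative D (Suc m) x) (at x within {0..})"
    and sgn: "\<And>m x. x \<ge> 0 \<Longrightarrow> (-1) ^ m * (c * D (Suc n + m) x) \<ge> 0"
  shows "completely_monotonic_on {0<..}
           (\<lambda>x. c * ((D 0 x - (\<Sum>k\<le>n. D k 0 / fact k * x ^ k)) / x ^ Suc n))"
proof -
  \<comment> \<open>\<open>F m\<close> is the \<open>m\<close>-th derivative in \<open>x\<close> of
    the integrand of the remainder, and \<open>E m\<close> the resulting candidate for the
    \<open>m\<close>-th derivative of the quotient.\<close>
  define F where "F m x t = (1 - t) ^ n * t ^ m * D (Suc n + m) (x * t)" for m and x t :: real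
  define E where "E m x = c / fact n * integral (cbox 0 1) (F m x)" for m x
  have contD: "continuous_on {0..} (D m)" for m
    by (rule DERIV_continuous_on[OF D]) auto
  have contF: "continuous_on ({0<..} \<times> cbox 0 1) (\<lambda>(x, t). F m x t)" for m
    unfolding F_def split_beta
    by (intro continuous_intros continuous_on_compose2[OF contD]) auto
  have intF: "F m x integrable_on cbox 0 1" if "x > 0" for m x
    unfolding F_def using that
    by (intro integrable_continuous continuous_intros continuous_on_compose2[OF contD]) auto
  have dF: "((\<lambda>x. F m x t) has_real_derivative F (Suc m) x t) (at x within {0<..})"
    if "x \<in> {0<..}" "t \<in> cbox 0 1" for m x t
  proof -
    have "((\<lambda>x. D (Suc n + m) (x * t)) has_real_derivative D (Suc (Suc n + m)) (x * t) * t)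
        (at x within {0<..})"
    proof (rule DERIV_image_chain[of "D (Suc n + m)" _ "\<lambda>x. x * t", unfolded o_def])
      show "(D (Suc n + m) has_real_derivative D (Suc (Suc n + m)) (x * t))
          (at (x * t) within (\<lambda>x. x * t) ` {0<..})"
        by (rule DERIV_subset[OF D]) (use that in auto)
    qed (auto intro!: derivative_eq_intros)
    from DERIV_cmult[OF this, of "(1 - t) ^ n * t ^ m"]
    show ?thesis by (simp add: F_def mult_ac)
  qed
  have "(E m has_real_derivative E (Suc m) x) (at x within {0<..})" if "x \<in> {0<..}" for m x
    unfolding E_def
    by (intro DERIV_cmult leibniz_rule_field_derivative dF intF contF that) (use that in auto)
  moreover have "E 0 x = c * ((D 0 x - (\<Sum>k\<le>n. D k 0 / fact k * x ^ k)) / x ^ Suc n)"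
    if "x \<in> {0<..}" for x
    using that taylor_remainder_quotient_eq_integral[of D, OF D, of x n]
    by (simp add: E_def F_def [abs_def])
  moreover have "(-1) ^ m * E m x \<ge> 0" if "x \<in> {0<..}" for m x
  proof -
    have "integral (cbox 0 1) (\<lambda>t. (-1) ^ m * c * F m x t) \<ge> 0"
    proof (rule integral_nonneg)
      show "(\<lambda>t. (-1) ^ m * c * F m x t) integrable_on cbox 0 1"
        using integrable_on_mult_right[OF intF[of x m], of "(-1) ^ m * c"] that by simp
      fix t :: real assume t: "t \<in> cbox 0 1"
      have "0 \<le> (1 - t) ^ n * t ^ m * ((-1) ^ m * (c * D (Suc n + m) (x * t)))"
        using t that by (intro mult_nonneg_nonneg[OF _ sgn]) auto
      then show "0 \<le> (-1) ^ m * c * F m x t" by (simp add: F_def mult_ac)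
    qed
    then show ?thesis by (simp add: E_def zero_le_divide_iff mult_ac)
  qed
  ultimately show ?thesis
    unfolding completely_monotonic_on_def by blast
qed

section \<open>Polygamma values and zeta values\<close>

lemma Gamma_legendre_duplication_real:
  assumes "(x::real) > 0"
  shows "Gamma x * Gamma (x + 1/2) = exp ((1 - 2 * x) * ln 2) * sqrt pi * Gamma (2 * x)"
proof -
  have npi: "complex_of_real y \<notin> \<int>\<^sub>\<le>\<^sub>0" if "y > 0" for y
    using that by (auto elim!: nonpos_Ints_cases' simp: complex_eq_iff)
  have "complex_of_real (Gamma x * Gamma (x + 1/2)) =
      Gamma (of_real x) * Gamma (of_real x + 1/2)"
    using Gamma_complex_of_real[of "x + 1/2"] by (simp add: Gamma_complex_of_real)
  also have "\<dots> = exp ((1 - 2 * of_real x) * of_real (ln 2)) * of_real (sqrt pi) *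
      Gamma (2 * of_real x)"
    using npi[of x] npi[of "x + 1/2"] assms by (intro Gamma_legendre_duplication) auto
  also have "\<dots> = of_real (exp ((1 - 2 * x) * ln 2) * sqrt pi * Gamma (2 * x))"
    using Gamma_complex_of_real[of "2 * x"] by (simp flip: exp_of_real)
  finally show ?thesis by (simp only: of_real_eq_iff)
qed

text \<open>The series of \<open>Polygamma n\<close> at 1 is the zeta series at n + 1; for n = 0 the
  latter would be the divergent harmonic series.\<close>

lemma zeta_sums_Polygamma:
  assumes "n > 0"
  shows "(\<lambda>k. inverse (real (Suc k) ^ Suc n)) sums ((-1) ^ Suc n * Polygamma n 1 / fact n)"
  using Polygamma_LIMSEQ[of "1::real" n] assms by simp

lemma zeta_eq_suminf_power: "zeta (real n) = (\<Sum>k. inverse (real (Suc k) ^ n))"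
  unfolding zeta_def by (simp add: powr_minus powr_realpow del: of_nat_Suc)

lemma zeta_eq_Polygamma:
  assumes "n > 0"
  shows "zeta (real (Suc n)) = (-1) ^ Suc n * Polygamma n 1 / fact n"
  unfolding zeta_eq_suminf_power using zeta_sums_Polygamma[OF assms] by (simp only: sums_iff)

text \<open>Termwise comparison; it bounds the zeta factors of the coefficients uniformly in
  \<open>n\<close>.\<close>

lemma zeta_le_zeta_2:
  assumes "n \<ge> 2"
  shows "zeta (real n) \<le> zeta 2"
proof -
  have smm: "summable (\<lambda>k. inverse (real (Suc k) ^ m))" if "m \<ge> 2" for m
    using zeta_sums_Polygamma[of "m - 1"] that by (auto simp: sums_iff simp del: of_nat_Suc)
  have "zeta (real n) \<le> zeta (real 2)"
    unfolding zeta_eq_suminf_power using assms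
    by (intro suminf_le smm le_imp_inverse_le power_increasing) auto
  then show ?thesis by simp
qed

section \<open>The derivatives of the logarithm\<close>

text \<open>The derivatives of ln (x/2 * B(x)) in duplicated form, which also makes sense at 0,
  where B itself has a pole. The linear term contributes only to the first derivative, hence the
  inner \<open>if\<close>.\<close>

definition log_beta_deriv :: "nat \<Rightarrow> real \<Rightarrow> real" where
  "log_beta_deriv n x = (case n of
      0 \<Rightarrow> ln_Gamma (x + 1) - ln_Gamma (x + 1/2) - 2 * ln 2 * x + ln pi / 2
    | Suc m \<Rightarrow> Polygamma m (x + 1) - Polygamma m (x + 1/2) - (if m = 0 then 2 * ln 2 else 0))"

lemma DERIV_log_beta_deriv:
  assumes "x > - (1/2)"
  shows "(log_beta_deriv n has_real_derivative log_beta_deriv (Suc n) x) (at x within A)"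
proof -
  have npi: "y \<notin> \<int>\<^sub>\<le>\<^sub>0" if "y > 0" for y :: real
    using that by (auto elim!: nonpos_Ints_cases')
  have "x + 1 \<notin> \<int>\<^sub>\<le>\<^sub>0" "x + 1/2 \<notin> \<int>\<^sub>\<le>\<^sub>0"
    using assms by (intro npi; simp)+
  then show ?thesis using assms
    by (cases n) (auto simp: log_beta_deriv_def [abs_def] intro!: derivative_eq_intros)
qed

lemma log_beta_deriv_0_eq:
  assumes "x > - (1/2)"
  shows "log_beta_deriv 0 x = 2 * ln_Gamma (x + 1) - ln_Gamma (2 * x + 1)"
proof -
  have pos: "Gamma (x + 1) > 0" "Gamma (x + 1/2) > 0" "Gamma (2 * x + 1) > 0"
    using assms by (auto intro!: Gamma_real_pos)
  have "Gamma (x + 1/2) * Gamma (x + 1) =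
      exp (- 2 * x * ln 2) * sqrt pi * Gamma (2 * x + 1)"
    using Gamma_legendre_duplication_real[of "x + 1/2"] assms
    by (simp add: algebra_simps)
  then have "ln (Gamma (x + 1/2) * Gamma (x + 1)) =
      ln (exp (- 2 * x * ln 2) * sqrt pi * Gamma (2 * x + 1))" by (rule arg_cong)
  with pos have "ln (Gamma (x + 1/2)) + ln (Gamma (x + 1)) =
      - 2 * x * ln 2 + ln pi / 2 + ln (Gamma (2 * x + 1))"
    by (simp add: ln_mult ln_sqrt)
  with assms show ?thesis
    by (simp add: log_beta_deriv_def ln_Gamma_real_pos algebra_simps)
qed

text \<open>The unduplicated form involves only polygamma values at 1 when differentiated at 0, with
  \<open>2 ^ Suc n\<close> coming from the chain rule. This avoids polygamma values at 1/2.\<close>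

lemma log_beta_deriv_Suc_at_0:
  "log_beta_deriv (Suc n) 0 = (2 - 2 ^ Suc n) * Polygamma n 1"
proof -
  define D where "D = (\<lambda>n x. case n of
      0 \<Rightarrow> 2 * ln_Gamma (x + 1) - ln_Gamma (2 * x + 1)
    | Suc m \<Rightarrow> 2 * Polygamma m (x + 1) - 2 ^ Suc m * Polygamma m (2 * x + 1 :: real))"
  define S where "S = {- (1/2 :: real)<..}"
  have S: "open S" "0 \<in> S" "\<And>x. x \<in> S \<longleftrightarrow> x > - (1/2)" by (auto simp: S_def)
  have D: "(D m has_real_derivative D (Suc m) x) (at x)" if "x \<in> S" for m x
  proof -
    have npi: "y \<notin> \<int>\<^sub>\<le>\<^sub>0" if "y > 0" for y :: real
      using that by (auto elim!: nonpos_Ints_cases')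
    have "x + 1 \<notin> \<int>\<^sub>\<le>\<^sub>0" "2 * x + 1 \<notin> \<int>\<^sub>\<le>\<^sub>0"
      using that by (intro npi; simp add: S)+
    then show ?thesis using that
      by (cases m) (auto simp: D_def S intro!: derivative_eq_intros)
  qed
  \<comment> \<open>Both towers differentiate the same function near 0, so they meet in its iterated
    \<open>deriv\<close>.\<close>
  have "log_beta_deriv (Suc n) 0 = (deriv ^^ Suc n) (log_beta_deriv 0) 0"
    by (rule higher_deriv_eqI(2)[symmetric, of S _ log_beta_deriv])
      (auto simp: S(1,3) intro: DERIV_log_beta_deriv)
  also have "\<dots> = D (Suc n) 0"
    by (rule higher_deriv_eqI(2)[of S _ D]) (auto simp: S(1,2) D, auto simp: S(3) log_beta_deriv_0_eq D_def)
  finally show ?thesis by (simp add: D_def algebra_simps)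
qed

lemma log_beta_deriv_at_0 [simp]: "log_beta_deriv 0 0 = 0" "log_beta_deriv (Suc 0) 0 = 0"
  by (simp_all add: log_beta_deriv_0_eq log_beta_deriv_Suc_at_0 ln_Gamma_real_pos)

text \<open>With n = m + 1, the value \<open>Polygamma m 1\<close> is (-1)^n m! zeta(n), and m!/n!
  leaves the denominator n.\<close>

lemma taylor_coeff_log_beta_deriv:
  assumes "n \<ge> 2"
  shows "log_beta_deriv n 0 / fact n = ln_central_beta_coeff n"
proof -
  obtain m where m: "n = Suc m" "m > 0" using assms by (cases n) auto
  show ?thesis
    using m by (simp add: log_beta_deriv_Suc_at_0 ln_central_beta_coeff_def zeta_eq_Polygamma
        field_simps flip: power_mult_distrib del: of_nat_Suc)
qed

lemma taylor_sum_log_beta_deriv: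
  assumes "n \<ge> 2"
  shows "(\<Sum>k\<le>n. log_beta_deriv k 0 / fact k * x ^ k) = (\<Sum>k=2..n. ln_central_beta_coeff k * x ^ k)"
proof -
  have "(\<Sum>k\<le>n. log_beta_deriv k 0 / fact k * x ^ k) =
      (\<Sum>k=2..n. log_beta_deriv k 0 / fact k * x ^ k)"
  proof (rule sum.mono_neutral_right)
    show "\<forall>k\<in>{..n} - {2..n}. log_beta_deriv k 0 / fact k * x ^ k = 0"
    proof
      fix k assume "k \<in> {..n} - {2..n}"
      then have "k = 0 \<or> k = Suc 0" by auto
      then show "log_beta_deriv k 0 / fact k * x ^ k = 0" by auto
    qed
  qed auto
  also have "\<dots> = (\<Sum>k=2..n. ln_central_beta_coeff k * x ^ k)"
    by (rule sum.cong) (auto simp: taylor_coeff_log_beta_deriv)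
  finally show ?thesis .
qed

text \<open>On the positive reals \<open>Polygamma m\<close> is strictly increasing for even
  \<open>m\<close> and strictly decreasing for odd \<open>m\<close>.\<close>

lemma log_beta_deriv_sign:
  assumes "n \<ge> 2" "x > - (1/2)"
  shows "(-1) ^ n * log_beta_deriv n x < 0"
proof -
  obtain m where m: "n = Suc m" "m > 0" using assms by (cases n) auto
  show ?thesis
    using Polygamma_real_strict_mono[of "x + 1/2" "x + 1" m]
      Polygamma_real_strict_antimono[of "x + 1/2" "x + 1" m] assms m
    by (cases "even m") (auto simp: log_beta_deriv_def)
qed

lemma log_beta_deriv_Suc_0_neg:
  assumes "x > 0"
  shows "log_beta_deriv (Suc 0) x < 0"
proof -
  have "log_beta_deriv (Suc 0) x < log_beta_deriv (Suc 0) 0"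
  proof (rule DERIV_neg_imp_decreasing[OF assms])
    fix y :: real assume "0 \<le> y" "y \<le> x"
    then show "\<exists>d. (log_beta_deriv (Suc 0) has_real_derivative d) (at y) \<and> d < 0"
      using DERIV_log_beta_deriv[of y "Suc 0"] log_beta_deriv_sign[of 2 y]
      by (auto simp: numeral_2_eq_2)
  qed
  then show ?thesis by simp
qed

lemma log_beta_deriv_0_neg:
  assumes "x > 0"
  shows "log_beta_deriv 0 x < 0"
proof -
  have "log_beta_deriv 0 x < log_beta_deriv 0 0"
  \<comment> \<open>The derivative vanishes at the left endpoint 0, so its negativity is available
    only on the open interval.\<close>
  proof (rule DERIV_neg_imp_decreasing_open[OF assms])
    show "continuous_on {0..x} (log_beta_deriv 0)"
      by (rule DERIV_continuous_on[OF DERIV_log_beta_deriv]) auto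
    fix y :: real assume "0 < y" "y < x"
    then show "\<exists>d. (log_beta_deriv 0 has_real_derivative d) (at y) \<and> d < 0"
      using DERIV_log_beta_deriv[of y 0] log_beta_deriv_Suc_0_neg[of y] by auto
  qed
  then show ?thesis by simp
qed

section \<open>The logarithm of the central beta function\<close>

lemma central_beta_pos:
  assumes "x > 0"
  shows "central_beta x > 0"
  unfolding central_beta_def using assms
  by (intro divide_pos_pos zero_less_power Gamma_real_pos) auto

text \<open>The functional equation of \<Gamma> turns x/2 * B(x) into
  \<open>Gamma (x + 1) ^ 2 / Gamma (2 * x + 1)\<close>.\<close>

lemma ln_central_beta:
  assumes "x > 0"
  shows "ln (central_beta x) = ln 2 - ln x + log_beta_deriv 0 x"
proof -
  have "Gamma x > 0" "Gamma (2 * x) > 0" using assms by (auto intro!: Gamma_real_pos)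
  then have "Gamma x \<noteq> 0" "Gamma (2 * x) \<noteq> 0" by linarith+
  moreover have "Gamma (x + 1) = x * Gamma x" "Gamma (2 * x + 1) = 2 * x * Gamma (2 * x)"
    using assms by (auto intro!: Gamma_plus1 elim!: nonpos_Ints_cases')
  ultimately show ?thesis
    using assms
    by (simp add: log_beta_deriv_0_eq ln_Gamma_real_pos central_beta_def ln_mult ln_div ln_realpow)
qed

lemma log_beta_remainder_quotient_completely_monotonic:
  assumes "n \<ge> 2"
  shows "completely_monotonic_on {0<..}
     (\<lambda>x. (-1) ^ n *
        ((log_beta_deriv 0 x - (\<Sum>k=2..n. ln_central_beta_coeff k * x ^ k)) / x ^ Suc n))"
proof -
  have "0 \<le> (-1) ^ m * ((-1) ^ n * log_beta_deriv (Suc n + m) x)" if "x \<ge> 0" for m x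
    using log_beta_deriv_sign[of "Suc n + m" x] assms that
    by (simp add: power_add mult_ac)
  from completely_monotonic_on_taylor_remainder_quotient[OF DERIV_log_beta_deriv this]
  show ?thesis unfolding taylor_sum_log_beta_deriv[OF assms] by simp
qed

lemma log_beta_remainder_sign:
  assumes "n \<ge> 2" "x > 0"
  shows "0 \<le> (-1) ^ n * (log_beta_deriv 0 x - (\<Sum>k=2..n. ln_central_beta_coeff k * x ^ k))"
  using completely_monotonic_on_nonneg[OF log_beta_remainder_quotient_completely_monotonic, of n x]
    assms zero_less_power[OF assms(2), of "Suc n"]
  by (simp add: zero_le_divide_iff not_le[symmetric] del: power_Suc zero_less_power)

text \<open>Consecutive remainders have weakly opposite signs and differ by one term of the series,
  so that term dominates the earlier remainder.\<close>

lemma log_beta_sums: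
  assumes "0 < x" "x \<le> 1/2"
  shows "(\<lambda>n. ln_central_beta_coeff (n + 2) * x ^ (n + 2)) sums log_beta_deriv 0 x"
proof -
  define R where "R n = log_beta_deriv 0 x - (\<Sum>k=2..n. ln_central_beta_coeff k * x ^ k)" for n
  have bound: "\<bar>R n\<bar> \<le> zeta 2 / real (Suc n)" if n: "n \<ge> 2" for n
  proof -
    have R_Suc: "R (Suc n) = R n - ln_central_beta_coeff (Suc n) * x ^ Suc n"
      using n by (simp add: R_def)
    have "0 \<le> (-1) ^ n * R n" "0 \<le> (-1) ^ Suc n * R (Suc n)"
      using log_beta_remainder_sign[of n x] log_beta_remainder_sign[of "Suc n" x] n assms
      by (simp_all add: R_def)
    then have "\<bar>R n\<bar> \<le> (-1) ^ n * (ln_central_beta_coeff (Suc n) * x ^ Suc n)"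
      unfolding R_Suc by (cases "even n") (auto simp del: power_Suc)
    also have "\<dots> = (2 ^ Suc n - 2) * x ^ Suc n * zeta (real (Suc n)) / real (Suc n)"
      by (simp add: ln_central_beta_coeff_def flip: power_mult_distrib)
    also have "\<dots> \<le> 1 * zeta 2 / real (Suc n)"
    proof (intro divide_right_mono mult_mono)
      \<comment> \<open>Here x <= 1/2 enters: (2x)^(n+1) <= 1 even at the endpoint, and the decay
        comes from the denominator n + 1 alone.\<close>
      have "(2 ^ Suc n - 2) * x ^ Suc n \<le> 2 ^ Suc n * (1/2) ^ Suc n"
        using assms by (intro mult_mono power_mono) auto
      then show "(2 ^ Suc n - 2) * x ^ Suc n \<le> 1" by (simp add: power_divide)
      show "zeta (real (Suc n)) \<le> zeta 2" using n by (intro zeta_le_zeta_2) auto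
      show "0 \<le> zeta (real (Suc n))"
        unfolding zeta_eq_suminf_power using zeta_sums_Polygamma[of n] n
        by (intro suminf_nonneg) (auto simp: sums_iff)
    qed auto
    finally show ?thesis by simp
  qed
  have "R \<longlonglongrightarrow> 0"
  proof (rule Lim_null_comparison)
    show "\<forall>\<^sub>F n in sequentially. norm (R n) \<le> zeta 2 / real (Suc n)"
      using bound by (auto simp: eventually_sequentially)
    show "(\<lambda>n. zeta 2 / real (Suc n)) \<longlonglongrightarrow> 0"
      by (rule filterlim_compose[OF lim_const_over_n filterlim_Suc])
  qed
  then have "(\<lambda>n. R (Suc n)) \<longlonglongrightarrow> 0" by (rule LIMSEQ_Suc)
  then have "(\<lambda>n. log_beta_deriv 0 x - R (Suc n)) \<longlonglongrightarrow> log_beta_deriv 0 x - 0"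
    by (intro tendsto_intros)
  \<comment> \<open>The first \<open>n\<close> terms of the shifted series are those with exponents
    2 to n + 1, hence \<open>R (Suc n)\<close>.\<close>
  moreover have "log_beta_deriv 0 x - R (Suc n) =
      (\<Sum>i<n. ln_central_beta_coeff (i + 2) * x ^ (i + 2))" for n
    by (induction n) (simp_all add: R_def)
  ultimately show ?thesis by (simp add: sums_def)
qed


theorem theorem1:
  shows
    "\<comment> \<open>(i)\<close>
     (let g = (\<lambda>x::real. ln (x / 2 * central_beta x)) in
        (\<forall>x>0. (\<forall>n. ((deriv ^^ n) g) field_differentiable (at x)) \<and>
          (-1) ^ 0 * (deriv ^^ 0) g x < 0 \<and>
          (-1) ^ 1 * (deriv ^^ 1) g x > 0 \<and>
          (\<forall>n\<ge>2. (-1) ^ n * (deriv ^^ n) g x < 0))) \<and>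
     completely_monotonic_on {0<..}
       (\<lambda>x. - (deriv ^^ 2) (\<lambda>y. ln (y * central_beta y)) x) \<and>
     \<comment> \<open>(ii)\<close>
     (\<forall>x\<in>{0<..1/2}.
        summable (\<lambda>n. ln_central_beta_coeff (n + 2) * x ^ (n + 2)) \<and>
        ln (central_beta x) =
          ln 2 - ln x + (\<Sum>n. ln_central_beta_coeff (n + 2) * x ^ (n + 2))) \<and>
     \<comment> \<open>(iii)\<close>
     (\<forall>n\<ge>2. completely_monotonic_on {0<..}
        (\<lambda>x. (-1) ^ n *
           ((ln (central_beta x) + ln x - ln 2 - (\<Sum>k=2..n. ln_central_beta_coeff k * x ^ k))
             / x ^ (n + 1))))"
proof (unfold Let_def, intro conjI ballI allI impI)
  \<comment> \<open>For \<open>c\<close> = 1/2 the constant \<open>ln (2 * c)\<close>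
    vanishes.\<close>
  have mult_eq: "ln (c * x * central_beta x) = ln (2 * c) + log_beta_deriv 0 x" if "x > 0" "c > 0" for c x
    using that central_beta_pos[of x] ln_central_beta[of x] by (simp add: ln_mult)
  let ?g = "\<lambda>x. ln (x / 2 * central_beta x)"
  have g: "((deriv ^^ n) ?g has_real_derivative log_beta_deriv (Suc n) x) (at x)"
    "(deriv ^^ n) ?g x = log_beta_deriv n x" if "x > 0" for n x
    using higher_deriv_eqI[of "{0<..}" ?g log_beta_deriv x n] DERIV_log_beta_deriv
      mult_eq[of _ "1/2"] that by auto
  fix x :: real assume x: "x > 0"
  show "(deriv ^^ n) ?g field_differentiable at x" for n
    using g(1)[OF x] by (auto simp: field_differentiable_def)
  show "(-1) ^ 0 * (deriv ^^ 0) ?g x < 0" "(-1) ^ 1 * (deriv ^^ 1) ?g x > 0"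
    unfolding g(2)[OF x] using log_beta_deriv_0_neg[OF x] log_beta_deriv_Suc_0_neg[OF x] by auto
  show "(-1) ^ n * (deriv ^^ n) ?g x < 0" if "n \<ge> 2" for n
    unfolding g(2)[OF x] using log_beta_deriv_sign[OF that] x by simp
next
  let ?h = "\<lambda>y. ln (y * central_beta y)"
  \<comment> \<open>Dropping the factor 1/2 adds \<open>ln 2\<close> to the logarithm, which no
    derivative sees; from order two on the signs are those of \<open>log_beta_deriv\<close>.\<close>
  define D where "D n x = log_beta_deriv n x + (if n = 0 then ln 2 else 0)" for n x
  have D: "(D n has_real_derivative D (Suc n) x) (at x within A)" if "x > 0" for n x A
    unfolding D_def [abs_def] using DERIV_log_beta_deriv[of x n A] that
    by (auto intro!: derivative_eq_intros)
  have h: "(deriv ^^ 2) ?h x = D 2 x" if "x > 0" for x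
  proof (rule higher_deriv_eqI(2)[of "{0<..}"])
    show "?h y = D 0 y" if "y \<in> {0<..}" for y
      using that central_beta_pos[of y] ln_central_beta[of y] by (simp add: ln_mult D_def)
  qed (use D that in auto)
  show "completely_monotonic_on {0<..} (\<lambda>x. - (deriv ^^ 2) ?h x)"
    unfolding completely_monotonic_on_def
  proof (intro exI[of _ "\<lambda>m x. - D (m + 2) x"] conjI allI ballI)
    fix m and x :: real assume x: "x \<in> {0<..}"
    then show "((\<lambda>x. - D (m + 2) x) has_real_derivative - D (Suc m + 2) x) (at x within {0<..})"
      using DERIV_minus[OF D[of x "m + 2"]] by simp
    show "0 \<le> (-1) ^ m * - D (m + 2) x"
      using log_beta_deriv_sign[of "m + 2" x] x by (simp add: D_def)
    show "- D (0 + 2) x = - (deriv ^^ 2) ?h x"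
      using h[of x] x by (simp only: greaterThan_iff add_0)
  qed
next
  fix x :: real assume x: "x \<in> {0<..1/2}"
  then have s: "(\<lambda>n. ln_central_beta_coeff (n + 2) * x ^ (n + 2)) sums log_beta_deriv 0 x"
    by (intro log_beta_sums) auto
  show "summable (\<lambda>n. ln_central_beta_coeff (n + 2) * x ^ (n + 2))"
    using s by (rule sums_summable)
  show "ln (central_beta x) =
      ln 2 - ln x + (\<Sum>n. ln_central_beta_coeff (n + 2) * x ^ (n + 2))"
    unfolding sums_unique[OF s, symmetric] using x by (intro ln_central_beta) auto
next
  fix n :: nat assume "n \<ge> 2"
  from log_beta_remainder_quotient_completely_monotonic[OF this]
  show "completely_monotonic_on {0<..}
      (\<lambda>x. (-1) ^ n *
         ((ln (central_beta x) + ln x - ln 2 - (\<Sum>k=2..n. ln_central_beta_coeff k * x ^ k))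
           / x ^ (n + 1)))"
    by (rule completely_monotonic_on_cong[THEN iffD1, rotated]) (simp add: ln_central_beta)
qed

end
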